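(* Let $X$ be a complex Banach space, let $\alpha\ge 0$, let $T\in\mathcal B(X)$ be a $(C,\alpha)$-bounded operator, and let $\beta>\alpha$. Then $T$ is $(C,\beta)$-ergodic if and only if $$X=\operatorname{Ker}(I-T)\oplus\overline{\operatorname{Ran}}(I-T).$$
   Context: $\mathcal B(X)$ is the algebra of bounded linear operators on $X$; $\overline{\operatorname{Ran}}(I-T)$ is the norm closure of the range of $I-T$. For $\alpha\in\mathbb R$ the Cesàro numbers are $k^\alpha(0)=1$, $k^\alpha(n)=\frac{\alpha(\alpha+1)\cdots(\alpha+n-1)}{n!}$ for $n\ge1$. For $T\in\mathcal B(X)$, $\alpha\ge0$ and $n\in\mathbb N_0=\{0,1,2,\dots\}$ put $\Delta^{-\alpha}\mathcal T(n)=\sum_{j=0}^n k^\alpha(n-j)T^j$ and $M_T^\alpha(n)=\frac{1}{k^{\alpha+1}(n)}\Delta^{-\alpha}\mathcal T(n)$. The operator $T$ is $(C,\alpha)$-bounded if $\sup_n\|M_T^\alpha(n)\|<\infty$, and $(C,\alpha)$-ergodic if $\lim_{n\to\infty}M_T^\alpha(n)x$ exists in norm for every $x\in X$. The sum is a topological direct sum. *)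

theory Defs
  imports "HOL-Analysis.Analysis"
begin

text \<open>
  Complex normed spaces as real ones whose real scalar multiplication is the restriction of a
  complex one, with the same norm.
\<close>

class complex_normed_vector = real_normed_vector +
  fixes scaleC :: "complex \<Rightarrow> 'a \<Rightarrow> 'a"  (infixr \<open>*\<^sub>C\<close> 75)
  assumes scaleC_add_right: "c *\<^sub>C (x + y) = c *\<^sub>C x + c *\<^sub>C y"
    and scaleC_add_left: "(c + d) *\<^sub>C x = c *\<^sub>C x + d *\<^sub>C x"
    and scaleC_scaleC: "c *\<^sub>C (d *\<^sub>C x) = (c * d) *\<^sub>C x"
    and scaleC_one: "1 *\<^sub>C x = x"
    and scaleR_scaleC: "r *\<^sub>R x = complex_of_real r *\<^sub>C x"
    and norm_scaleC: "norm (c *\<^sub>C x) = cmod c * norm x"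

class complex_banach = complex_normed_vector + banach

instantiation complex :: complex_banach
begin

definition scaleC_complex :: "complex \<Rightarrow> complex \<Rightarrow> complex" where
  "scaleC_complex c x = c * x"

instance
  by standard (simp_all add: scaleC_complex_def algebra_simps norm_mult scaleR_conv_of_real)

end

definition csubspace :: "'a::complex_normed_vector set \<Rightarrow> bool" where
  "csubspace U \<longleftrightarrow> 0 \<in> U \<and> (\<forall>x\<in>U. \<forall>y\<in>U. x + y \<in> U) \<and> (\<forall>c. \<forall>x\<in>U. c *\<^sub>C x \<in> U)"

text \<open>
  Bijectivity of addition \<open>U \<times> V \<rightarrow> X\<close> says that the sum is direct and equal to \<open>X\<close>; continuity
  of its inverse says that the two associated projections are continuous.
\<close>

definition topological_direct_sum :: "'a::complex_normed_vector set \<Rightarrow> 'a set \<Rightarrow> bool" where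
  "topological_direct_sum U V \<longleftrightarrow> csubspace U \<and> csubspace V \<and>
     (\<exists>g. homeomorphism (U \<times> V) UNIV (\<lambda>(u, v). u + v) g)"

text \<open>
  The type \<open>'a \<Rightarrow>\<^sub>L 'a\<close> consists of the real-linear bounded operators; together with the following
  condition it yields the bounded complex-linear ones, with the same operator norm.
\<close>

definition complex_homogeneous :: "('a::complex_normed_vector \<Rightarrow>\<^sub>L 'a) \<Rightarrow> bool" where
  "complex_homogeneous T \<longleftrightarrow> (\<forall>c x. blinfun_apply T (c *\<^sub>C x) = c *\<^sub>C blinfun_apply T x)"

definition cesaro_number :: "real \<Rightarrow> nat \<Rightarrow> real" where
  "cesaro_number \<alpha> n = pochhammer \<alpha> n / fact n"

definition blinfun_power :: "('a::real_normed_vector \<Rightarrow>\<^sub>L 'a) \<Rightarrow> nat \<Rightarrow> 'a \<Rightarrow>\<^sub>L 'a" where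
  "blinfun_power T n = (blinfun_compose T ^^ n) id_blinfun"

definition cesaro_sum :: "real \<Rightarrow> ('a::real_normed_vector \<Rightarrow>\<^sub>L 'a) \<Rightarrow> nat \<Rightarrow> 'a \<Rightarrow>\<^sub>L 'a" where
  "cesaro_sum \<alpha> T n = (\<Sum>j=0..n. cesaro_number \<alpha> (n - j) *\<^sub>R blinfun_power T j)"

definition cesaro_mean :: "real \<Rightarrow> ('a::real_normed_vector \<Rightarrow>\<^sub>L 'a) \<Rightarrow> nat \<Rightarrow> 'a \<Rightarrow>\<^sub>L 'a" where
  "cesaro_mean \<alpha> T n = (1 / cesaro_number (\<alpha> + 1) n) *\<^sub>R cesaro_sum \<alpha> T n"

definition cesaro_bounded :: "real \<Rightarrow> ('a::real_normed_vector \<Rightarrow>\<^sub>L 'a) \<Rightarrow> bool" where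
  "cesaro_bounded \<alpha> T \<longleftrightarrow> bdd_above (range (\<lambda>n. norm (cesaro_mean \<alpha> T n)))"

definition cesaro_ergodic :: "real \<Rightarrow> ('a::real_normed_vector \<Rightarrow>\<^sub>L 'a) \<Rightarrow> bool" where
  "cesaro_ergodic \<alpha> T \<longleftrightarrow> (\<forall>x. convergent (\<lambda>n. blinfun_apply (cesaro_mean \<alpha> T n) x))"

end

theory Submission
  imports Defs "HOL-Real_Asymp.Real_Asymp"
begin

text \<open>
  Write \<open>S\<^bsup>a\<^esup>(n)\<close> for the Cesaro sum of order \<open>a\<close> and \<open>M\<^bsup>a\<^esup>(n)\<close> for the mean. Since
  \<open>M\<^bsup>\<beta>\<^esup>(n)\<close> is the identity on the kernel of \<open>I - T\<close> and \<open>x - M\<^bsup>\<beta>\<^esup>(n) x\<close> lies in the range of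
  \<open>I - T\<close>, it suffices, by Eberlein's argument for ergodic nets, to show that these means are
  bounded and that \<open>M\<^bsup>\<beta>\<^esup>(n) (I - T) \<rightarrow> 0\<close>: then \<open>M\<^bsup>\<beta>\<^esup>(n) x \<rightarrow> y\<close> holds exactly when \<open>y\<close> is in the
  kernel and \<open>x - y\<close> in the closed range.

  The convolution law \<open>k\<^bsup>a\<^esup> * k\<^bsup>b\<^esup> = k\<^bsup>a+b\<^esup>\<close> gives \<open>S\<^bsup>a+b\<^esup> = k\<^bsup>a\<^esup> * S\<^bsup>b\<^esup>\<close>. As \<open>k\<^bsup>b-a\<^esup> \<ge> 0\<close> for
  \<open>b \<ge> a\<close>, boundedness of the means passes from \<open>a\<close> to \<open>b\<close>. So we may assume that \<open>\<beta> - 1 \<le> \<alpha> < \<beta>\<close>; then the only positive term of \<open>k\<^bsup>\<beta>-1-\<alpha>\<^esup>\<close> is the one of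
  index \<open>0\<close>, hence \<open>\<parallel>S\<^bsup>\<beta>-1\<^esup>(n)\<parallel> = O(k\<^bsup>\<alpha>+1\<^esup>(n)) = o(k\<^bsup>\<beta>+1\<^esup>(n))\<close>, and
  \<open>S\<^bsup>\<beta>\<^esup>(n) (I - T) = k\<^bsup>\<beta>\<^esup>(n+1) I - S\<^bsup>\<beta>-1\<^esup>(n+1)\<close>.
\<close>

subsection \<open>Complex subspaces\<close>

lemma bounded_bilinear_scaleC:
  "bounded_bilinear ((*\<^sub>C) :: complex \<Rightarrow> 'a::complex_normed_vector \<Rightarrow> 'a)"
proof
  show "(r *\<^sub>R c) *\<^sub>C x = r *\<^sub>R (c *\<^sub>C x)" for r c and x :: 'a
    by (simp add: scaleR_conv_of_real scaleC_scaleC scaleR_scaleC [of r "c *\<^sub>C x"])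
  show "c *\<^sub>C (r *\<^sub>R x) = r *\<^sub>R (c *\<^sub>C x)" for r c and x :: 'a
    by (simp add: scaleR_scaleC scaleC_scaleC mult.commute)
  show "\<exists>K. \<forall>c x. norm (c *\<^sub>C x :: 'a) \<le> norm c * norm x * K"
    by (intro exI [of _ 1]) (simp add: norm_scaleC)
qed (rule scaleC_add_left scaleC_add_right)+

interpretation scaleC: bounded_bilinear "(*\<^sub>C) :: complex \<Rightarrow> 'a::complex_normed_vector \<Rightarrow> 'a"
  by (rule bounded_bilinear_scaleC)

lemma csubspace_kernel:
  assumes "complex_homogeneous A"
  shows "csubspace {x. A x = 0}"
  using assms
  by (simp add: csubspace_def complex_homogeneous_def blinfun.zero_right blinfun.add_right
      scaleC.zero_right)

lemma csubspace_range:
  assumes "complex_homogeneous A"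
  shows "csubspace (range A)"
  unfolding csubspace_def
proof (intro conjI ballI allI)
  show "0 \<in> range A"
    by (metis blinfun.zero_right rangeI)
  show "x + y \<in> range A" if "x \<in> range A" "y \<in> range A" for x y
    using that by (auto simp: blinfun.add_right [symmetric])
  show "c *\<^sub>C x \<in> range A" if "x \<in> range A" for c x
    using that assms unfolding complex_homogeneous_def by (metis rangeE rangeI)
qed

lemma csubspace_closure:
  assumes "csubspace U"
  shows "csubspace (closure U)"
  unfolding csubspace_def
proof (intro conjI ballI allI)
  show "0 \<in> closure U"
    using assms closure_subset by (auto simp: csubspace_def)
  have "(\<lambda>p. fst p + snd p) ` closure (U \<times> U) \<subseteq> closure U"
    using assms
    by (intro image_closure_subset continuous_intros)
      (auto simp: csubspace_def intro: subsetD [OF closure_subset])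
  then show "x + y \<in> closure U" if "x \<in> closure U" "y \<in> closure U" for x y
    using that by (force simp: closure_Times)
  have "(*\<^sub>C) c ` closure U \<subseteq> closure U" for c
    using assms
    by (intro image_closure_subset scaleC.continuous_on continuous_intros)
      (auto simp: csubspace_def intro: subsetD [OF closure_subset])
  then show "c *\<^sub>C x \<in> closure U" if "x \<in> closure U" for c x
    using that by blast
qed

lemma complex_homogeneous_id_diff:
  assumes "complex_homogeneous T"
  shows "complex_homogeneous (id_blinfun - T)"
  using assms by (simp add: complex_homogeneous_def blinfun.diff_left scaleC.diff_right)

subsection \<open>Ergodic nets\<close>

lemma closed_tendsto_0_blinfun:
  fixes M :: "'i \<Rightarrow> 'a::real_normed_vector \<Rightarrow>\<^sub>L 'b::real_normed_vector"
  assumes "bounded (range M)"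
  shows "closed {x. ((\<lambda>i. M i x) \<longlongrightarrow> 0) F}"
proof -
  obtain C where C_pos: "0 < C" and norm_le: "\<And>i. norm (M i) \<le> C"
    using assms by (auto simp: bounded_pos)
  have "((\<lambda>i. M i x) \<longlongrightarrow> 0) F" if in_closure: "x \<in> closure {x. ((\<lambda>i. M i x) \<longlongrightarrow> 0) F}" for x
  proof (rule tendstoI)
    fix e :: real assume e_pos: "0 < e"
    then have "0 < e / (2 * C)"
      using C_pos by simp
    then obtain y where lim: "((\<lambda>i. M i y) \<longlongrightarrow> 0) F" and close: "dist y x < e / (2 * C)"
      using in_closure unfolding closure_approachable by blast
    have norm_diff: "norm (M i (x - y)) < e / 2" for i
    proof -
      have "norm (M i (x - y)) \<le> C * norm (x - y)"
        using norm_blinfun mult_right_mono [OF norm_le norm_ge_zero] by (rule order_trans)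
      also have "\<dots> < e / 2"
        using close C_pos by (simp add: dist_norm norm_minus_commute field_simps)
      finally show ?thesis .
    qed
    have "\<forall>\<^sub>F i in F. dist (M i y) 0 < e / 2"
      using lim e_pos by (intro tendstoD) auto
    then show "\<forall>\<^sub>F i in F. dist (M i x) 0 < e"
    proof eventually_elim
      case (elim i)
      have "norm (M i x) \<le> norm (M i (x - y)) + norm (M i y)"
        using norm_triangle_ineq [of "M i (x - y)" "M i y"] by (simp add: blinfun.diff_right)
      then show ?case
        using elim norm_diff [of i] by simp
    qed
  qed
  then show ?thesis
    unfolding closure_subset_eq [symmetric] by blast
qed

lemma bounded_linear_pointwise_limit:
  fixes M :: "'i \<Rightarrow> 'a::real_normed_vector \<Rightarrow>\<^sub>L 'b::real_normed_vector"
  assumes "bounded (range M)" and nontrivial: "F \<noteq> bot"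
    and lim: "\<And>x. ((\<lambda>i. M i x) \<longlongrightarrow> P x) F"
  shows "bounded_linear P"
proof -
  obtain C where norm_le: "\<And>i. norm (M i) \<le> C"
    using assms(1) by (auto simp: bounded_iff)
  show ?thesis
  proof (rule bounded_linear_intro)
    show "P (x + y) = P x + P y" for x y
      using tendsto_add [OF lim lim, of x y]
      by (intro tendsto_unique [OF nontrivial lim]) (simp add: blinfun.add_right)
    show "P (r *\<^sub>R x) = r *\<^sub>R P x" for r x
      using tendsto_scaleR [OF tendsto_const lim, of r x]
      by (intro tendsto_unique [OF nontrivial lim]) (simp add: blinfun.scaleR_right)
    show "norm (P x) \<le> norm x * C" for x
    proof (rule tendsto_upperbound [OF tendsto_norm [OF lim] _ nontrivial])
      have "norm (M i x) \<le> norm x * C" for i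
        using norm_blinfun mult_right_mono [OF norm_le norm_ge_zero]
        by (metis order_trans mult.commute)
      then show "\<forall>\<^sub>F i in F. norm (M i x) \<le> norm x * C"
        by simp
    qed
  qed
qed

locale ergodic_net =
  fixes A :: "'a::real_normed_vector \<Rightarrow>\<^sub>L 'a" and M :: "'i \<Rightarrow> 'a \<Rightarrow>\<^sub>L 'a" and F :: "'i filter"
  assumes nontrivial: "F \<noteq> bot"
    and bounded: "bounded (range M)"
    and mean_kernel: "A x = 0 \<Longrightarrow> M i x = x"
    and diff_mean_in_closure: "x - M i x \<in> closure (range A)"
    and range_mean_tendsto_0: "((\<lambda>i. A (M i x)) \<longlongrightarrow> 0) F"
    and mean_range_tendsto_0: "((\<lambda>i. M i (A x)) \<longlongrightarrow> 0) F"
begin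

lemma mean_closure_range_tendsto_0:
  assumes "x \<in> closure (range A)"
  shows "((\<lambda>i. M i x) \<longlongrightarrow> 0) F"
proof -
  have "closure (range A) \<subseteq> {x. ((\<lambda>i. M i x) \<longlongrightarrow> 0) F}"
    using mean_range_tendsto_0 by (intro closure_minimal closed_tendsto_0_blinfun bounded) auto
  with assms show ?thesis by blast
qed

lemma mean_tendsto_iff: "((\<lambda>i. M i x) \<longlongrightarrow> y) F \<longleftrightarrow> A y = 0 \<and> x - y \<in> closure (range A)"
proof (intro iffI conjI)
  assume lim: "((\<lambda>i. M i x) \<longlongrightarrow> y) F"
  have "((\<lambda>i. A (M i x)) \<longlongrightarrow> A y) F"
    by (intro blinfun.tendsto tendsto_const lim)
  then show "A y = 0"
    using range_mean_tendsto_0 by (rule tendsto_unique [OF nontrivial])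
  show "x - y \<in> closure (range A)"
    using diff_mean_in_closure
    by (intro Lim_in_closed_set [OF closed_closure _ nontrivial tendsto_diff [OF tendsto_const lim]])
      simp
next
  assume decomposition: "A y = 0 \<and> x - y \<in> closure (range A)"
  then have "((\<lambda>i. y + M i (x - y)) \<longlongrightarrow> y + 0) F"
    by (intro tendsto_add tendsto_const mean_closure_range_tendsto_0) simp
  then show "((\<lambda>i. M i x) \<longlongrightarrow> y) F"
    using decomposition mean_kernel by (simp add: blinfun.diff_right)
qed

lemma all_convergent_iff_direct_sum:
  "(\<forall>x. \<exists>y. ((\<lambda>i. M i x) \<longlongrightarrow> y) F) \<longleftrightarrow>
    (\<exists>g. homeomorphism ({x. A x = 0} \<times> closure (range A)) UNIV (\<lambda>(u, v). u + v) g)"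
    (is "?convergent \<longleftrightarrow> (\<exists>g. homeomorphism (?K \<times> ?R) UNIV ?add g)")
proof
  assume ?convergent
  then obtain P where limit: "\<And>x. ((\<lambda>i. M i x) \<longlongrightarrow> P x) F"
    by metis
  have P_sum: "P (u + v) = u" if "u \<in> ?K" "v \<in> ?R" for u v
    using that by (intro tendsto_unique [OF nontrivial limit]) (simp add: mean_tendsto_iff)
  have "continuous_on UNIV P"
    by (intro linear_continuous_on bounded_linear_pointwise_limit [OF bounded nontrivial limit])
  then have "homeomorphism (?K \<times> ?R) UNIV ?add (\<lambda>x. (P x, x - P x))"
    using limit by (intro homeomorphismI)
      (auto intro!: continuous_intros simp: case_prod_unfold mean_tendsto_iff P_sum)
  then show "\<exists>g. homeomorphism (?K \<times> ?R) UNIV ?add g"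
    by blast
next
  assume "\<exists>g. homeomorphism (?K \<times> ?R) UNIV ?add g"
  then have "?add ` (?K \<times> ?R) = UNIV"
    unfolding homeomorphism_def by blast
  then have "\<exists>u\<in>?K. \<exists>v\<in>?R. x = u + v" for x
    by (force simp: image_iff)
  then show ?convergent
    unfolding mean_tendsto_iff by (metis add_diff_cancel_left' mem_Collect_eq)
qed

end

subsection \<open>Cesaro numbers\<close>

lemma cesaro_number_0 [simp]: "cesaro_number a 0 = 1"
  by (simp add: cesaro_number_def)

lemma cesaro_number_1 [simp]: "cesaro_number 1 n = 1"
  by (simp add: cesaro_number_def flip: pochhammer_fact)

lemma cesaro_number_nonneg: "0 \<le> a \<Longrightarrow> 0 \<le> cesaro_number a n"
  by (simp add: cesaro_number_def pochhammer_prod prod_nonneg)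

lemma cesaro_number_pos: "0 < a \<Longrightarrow> 0 < cesaro_number a n"
  by (simp add: cesaro_number_def pochhammer_pos)

lemma cesaro_number_Suc_nonpos:
  assumes "-1 \<le> a" "a \<le> 0"
  shows "cesaro_number a (Suc n) \<le> 0"
proof -
  have "cesaro_number a (Suc n) = a / real (Suc n) * cesaro_number (a + 1) n"
    by (simp add: cesaro_number_def pochhammer_rec)
  also have "\<dots> \<le> 0"
    using assms by (intro mult_nonpos_nonneg divide_nonpos_pos cesaro_number_nonneg) auto
  finally show ?thesis .
qed

lemma cesaro_number_convolution:
  "(\<Sum>i=0..n. cesaro_number a (n - i) * cesaro_number b i) = cesaro_number (a + b) n"
proof -
  have "cesaro_number (a + b) n
      = (\<Sum>i=0..n. real (n choose i) * pochhammer b i * pochhammer a (n - i) / fact n)"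
    unfolding cesaro_number_def add.commute [of a b] pochhammer_binomial_sum
    by (simp add: sum_divide_distrib atLeast0AtMost)
  also have "\<dots> = (\<Sum>i=0..n. cesaro_number a (n - i) * cesaro_number b i)"
    by (intro sum.cong refl) (simp add: cesaro_number_def binomial_fact mult.commute)
  finally show ?thesis ..
qed

lemma sum_cesaro_number: "(\<Sum>i=0..n. cesaro_number a (n - i)) = cesaro_number (a + 1) n"
  using cesaro_number_convolution [of a n 1] by simp

lemma sum_abs_cesaro_number_le:
  assumes "-1 \<le> d" "d \<le> 0" "0 \<le> d + a"
  shows "(\<Sum>i=0..n. \<bar>cesaro_number d (n - i)\<bar> * cesaro_number a i) \<le> 2 * cesaro_number a n"
proof -
  have abs_eq: "\<bar>cesaro_number d m\<bar> = (if m = 0 then 2 else 0) - cesaro_number d m" for m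
    using assms cesaro_number_Suc_nonpos [of d "m - 1"] by auto
  have "(\<Sum>i=0..n. \<bar>cesaro_number d (n - i)\<bar> * cesaro_number a i)
      = (\<Sum>i=0..n. (if i = n then 2 * cesaro_number a i else 0)
          - cesaro_number d (n - i) * cesaro_number a i)"
    unfolding abs_eq by (intro sum.cong) (auto simp: algebra_simps)
  also have "\<dots> = 2 * cesaro_number a n - cesaro_number (d + a) n"
    by (simp add: sum_subtractf cesaro_number_convolution)
  finally show ?thesis
    using cesaro_number_nonneg [OF assms(3), of n] by simp
qed

lemma cesaro_number_asymptotic:
  "(\<lambda>n. cesaro_number a n / real n powr (a - 1)) \<longlonglongrightarrow> inverse (Gamma a)"
proof -
  have "\<forall>\<^sub>F n in sequentially.
      (- a gchoose n) / ((-1) ^ n / exp ((- a + 1) * of_real (ln (real n))))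
        = cesaro_number a n / real n powr (a - 1)"
    using eventually_gt_at_top [of 0]
  proof eventually_elim
    case (elim n)
    have "exp ((- a + 1) * ln (real n)) = inverse (real n powr (a - 1))"
      using elim by (simp add: powr_def algebra_simps flip: exp_minus)
    then show ?case
      by (simp add: cesaro_number_def gbinomial_pochhammer field_simps)
  qed
  then show ?thesis
    using gbinomial_asymptotic [of "- a"] by (simp add: filterlim_cong)
qed

lemma cesaro_number_Suc_ratio_tendsto_0:
  assumes "a < b" "0 < b"
  shows "(\<lambda>n. cesaro_number a (Suc n) / cesaro_number b n) \<longlonglongrightarrow> 0"
proof -
  let ?q = "\<lambda>a n. cesaro_number a n / real n powr (a - 1)"
  have powr_ratio: "(\<lambda>n. real (Suc n) powr (a - 1) / real n powr (b - 1)) \<longlonglongrightarrow> 0"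
    using assms by real_asymp
  have "Gamma b \<noteq> 0"
    using assms Gamma_real_pos [of b] by linarith
  then have "(\<lambda>n. ?q a (Suc n) / ?q b n * (real (Suc n) powr (a - 1) / real n powr (b - 1)))
      \<longlonglongrightarrow> inverse (Gamma a) / inverse (Gamma b) * 0"
    by (intro tendsto_intros LIMSEQ_Suc [OF cesaro_number_asymptotic] cesaro_number_asymptotic
        powr_ratio) simp
  moreover have "\<forall>\<^sub>F n in sequentially.
      ?q a (Suc n) / ?q b n * (real (Suc n) powr (a - 1) / real n powr (b - 1))
        = cesaro_number a (Suc n) / cesaro_number b n"
    using eventually_gt_at_top [of 0] by eventually_elim simp
  ultimately show ?thesis
    by (simp add: filterlim_cong)
qed

subsection \<open>Cesaro sums\<close>

lemma blinfun_power_apply: "blinfun_power T n x = (blinfun_apply T ^^ n) x"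
  by (induction n) (simp_all add: blinfun_power_def)

lemma cesaro_sum_apply:
  "cesaro_sum a T n x = (\<Sum>j=0..n. cesaro_number a (n - j) *\<^sub>R (blinfun_apply T ^^ j) x)"
  by (simp add: cesaro_sum_def blinfun.sum_left blinfun.scaleR_left blinfun_power_apply)

lemma cesaro_sum_convolution:
  "cesaro_sum (a + b) T n = (\<Sum>i=0..n. cesaro_number a (n - i) *\<^sub>R cesaro_sum b T i)"
proof -
  have "(\<Sum>i=0..n. cesaro_number a (n - i) *\<^sub>R cesaro_sum b T i)
      = (\<Sum>i=0..n. \<Sum>j=0..i.
          (cesaro_number a (n - i) * cesaro_number b (i - j)) *\<^sub>R blinfun_power T j)"
    by (simp add: cesaro_sum_def scaleR_sum_right)
  also have "\<dots> = (\<Sum>j=0..n. \<Sum>i=0..n-j.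
          (cesaro_number a (n - j - i) * cesaro_number b i) *\<^sub>R blinfun_power T j)"
    by (rule fps_mult_assoc_lemma)
  also have "\<dots> = cesaro_sum (a + b) T n"
    by (simp only: cesaro_sum_def cesaro_number_convolution scaleR_sum_left [symmetric])
  finally show ?thesis ..
qed

lemma cesaro_sum_Suc:
  "cesaro_sum a T (Suc n) = cesaro_number a (Suc n) *\<^sub>R id_blinfun + (cesaro_sum a T n o\<^sub>L T)"
proof (rule blinfun_eqI)
  fix x
  show "cesaro_sum a T (Suc n) x
      = (cesaro_number a (Suc n) *\<^sub>R id_blinfun + (cesaro_sum a T n o\<^sub>L T)) x"
    unfolding blinfun.add_left blinfun.scaleR_left blinfun_apply_blinfun_compose cesaro_sum_apply
    by (subst sum.atLeast0_atMost_Suc_shift) (simp add: funpow_swap1)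
qed

lemma cesaro_sum_diff:
  "cesaro_sum (a - 1) T (Suc n) = cesaro_sum a T (Suc n) - cesaro_sum a T n"
proof -
  have "cesaro_sum a T m = (\<Sum>i=0..m. cesaro_sum (a - 1) T i)" for m
    using cesaro_sum_convolution [of 1 "a - 1" T m] by simp
  then show ?thesis by simp
qed

lemma cesaro_sum_compose_id_diff:
  "cesaro_sum a T n o\<^sub>L (id_blinfun - T)
    = cesaro_number a (Suc n) *\<^sub>R id_blinfun - cesaro_sum (a - 1) T (Suc n)"
  unfolding cesaro_sum_diff [of a]
  by (rule blinfun_eqI) (simp add: cesaro_sum_Suc blinfun.bilinear_simps)

lemma norm_cesaro_sum_add_le:
  assumes "\<And>n. norm (cesaro_sum a T n) \<le> C * cesaro_number (a + 1) n"
  shows "norm (cesaro_sum (d + a) T n)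
    \<le> C * (\<Sum>i=0..n. \<bar>cesaro_number d (n - i)\<bar> * cesaro_number (a + 1) i)"
proof -
  have "norm (cesaro_sum (d + a) T n)
      \<le> (\<Sum>i=0..n. \<bar>cesaro_number d (n - i)\<bar> * norm (cesaro_sum a T i))"
    unfolding cesaro_sum_convolution by (rule sum_norm_le) simp
  also have "\<dots> \<le> (\<Sum>i=0..n. \<bar>cesaro_number d (n - i)\<bar> * (C * cesaro_number (a + 1) i))"
    by (intro sum_mono mult_left_mono assms) simp
  finally show ?thesis
    by (simp add: sum_distrib_left mult_ac)
qed

subsection \<open>Cesaro means\<close>

lemma cesaro_mean_apply:
  "cesaro_mean a T n x
    = (1 / cesaro_number (a + 1) n) *\<^sub>R
      (\<Sum>j=0..n. cesaro_number a (n - j) *\<^sub>R (blinfun_apply T ^^ j) x)"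
  by (simp add: cesaro_mean_def blinfun.scaleR_left cesaro_sum_apply)

lemma cesaro_mean_commute: "blinfun_apply T (cesaro_mean a T n x) = cesaro_mean a T n (T x)"
  by (simp add: cesaro_mean_apply blinfun.scaleR_right blinfun.sum_right funpow_swap1)

lemma cesaro_mean_fixed:
  assumes "-1 < a" "blinfun_apply T x = x"
  shows "cesaro_mean a T n x = x"
proof -
  have "(blinfun_apply T ^^ j) x = x" for j
    by (induction j) (simp_all add: assms)
  then show ?thesis
    using cesaro_number_pos [of "a + 1" n] assms
    by (simp add: cesaro_mean_apply sum_cesaro_number flip: scaleR_sum_left)
qed

lemma diff_cesaro_mean_in_range:
  assumes "-1 < a"
  shows "x - cesaro_mean a T n x \<in> range (id_blinfun - T)"
proof -
  have subspace_range: "subspace (range (id_blinfun - T))"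
    by (intro linear_subspace_image bounded_linear.linear blinfun.bounded_linear_right) simp
  have "x - (blinfun_apply T ^^ j) x = (id_blinfun - T) (\<Sum>i<j. (blinfun_apply T ^^ i) x)" for j
    using sum_lessThan_telescope' [of "\<lambda>i. (blinfun_apply T ^^ i) x" j]
    by (simp add: blinfun.diff_left blinfun.sum_right sum_subtractf)
  then have "x - (blinfun_apply T ^^ j) x \<in> range (id_blinfun - T)" for j
    by simp
  then have "(1 / cesaro_number (a + 1) n) *\<^sub>R
      (\<Sum>j=0..n. cesaro_number a (n - j) *\<^sub>R (x - (blinfun_apply T ^^ j) x))
        \<in> range (id_blinfun - T)"
    by (intro subspace_scale subspace_sum subspace_range)
  then show ?thesis
    using cesaro_number_pos [of "a + 1" n] assms
    by (simp add: cesaro_mean_apply scaleR_diff_right sum_subtractf sum_cesaro_number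
        flip: scaleR_sum_left)
qed

lemma cesaro_bounded_iff:
  assumes "-1 < a"
  shows "cesaro_bounded a T \<longleftrightarrow>
    (\<exists>C\<ge>0. \<forall>n. norm (cesaro_sum a T n) \<le> C * cesaro_number (a + 1) n)"
proof -
  have "norm (cesaro_mean a T n) \<le> C \<longleftrightarrow> norm (cesaro_sum a T n) \<le> C * cesaro_number (a + 1) n"
    for C n
    using cesaro_number_pos [of "a + 1" n] assms by (simp add: cesaro_mean_def pos_divide_le_eq)
  moreover have "0 \<le> C" if "\<forall>n. norm (cesaro_mean a T n) \<le> C" for C
    using that norm_ge_zero order_trans by blast
  ultimately show ?thesis
    unfolding cesaro_bounded_def bdd_above_def by auto
qed

lemma cesaro_bounded_mono:
  assumes "-1 < a" "a \<le> b" "cesaro_bounded a T"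
  shows "cesaro_bounded b T"
proof -
  obtain C where "0 \<le> C" and sum_le: "\<And>n. norm (cesaro_sum a T n) \<le> C * cesaro_number (a + 1) n"
    using assms by (auto simp: cesaro_bounded_iff)
  have "norm (cesaro_sum b T n) \<le> C * cesaro_number (b + 1) n" for n
    using norm_cesaro_sum_add_le [OF sum_le, of "b - a" n]
      cesaro_number_convolution [of "b - a" n "a + 1"] assms
    by (simp add: cesaro_number_nonneg)
  then show ?thesis
    using assms \<open>0 \<le> C\<close> by (auto simp: cesaro_bounded_iff)
qed

lemma norm_cesaro_sum_pred_le:
  assumes "-1 < a" "a < b" "0 \<le> b" "cesaro_bounded a T"
  obtains C c where "c < b" "\<And>n. norm (cesaro_sum (b - 1) T n) \<le> C * cesaro_number (c + 1) n"
proof -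
  define c where "c = max a (b - 1)"
  have c_bounds: "-1 < c" "a \<le> c" "c < b" "b - 1 \<le> c"
    using assms by (auto simp: c_def)
  have "cesaro_bounded c T"
    using cesaro_bounded_mono [of a c T] assms c_bounds by simp
  then obtain C where "0 \<le> C"
    and sum_le: "\<And>n. norm (cesaro_sum c T n) \<le> C * cesaro_number (c + 1) n"
    using c_bounds by (auto simp: cesaro_bounded_iff)
  have "norm (cesaro_sum (b - 1) T n) \<le> C * 2 * cesaro_number (c + 1) n" for n
  proof -
    have "norm (cesaro_sum (b - 1) T n)
        \<le> C * (\<Sum>i=0..n. \<bar>cesaro_number (b - 1 - c) (n - i)\<bar> * cesaro_number (c + 1) i)"
      using norm_cesaro_sum_add_le [OF sum_le, of "b - 1 - c" n] by simp
    also have "\<dots> \<le> C * (2 * cesaro_number (c + 1) n)"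
      using assms c_bounds \<open>0 \<le> C\<close> by (intro mult_left_mono sum_abs_cesaro_number_le) auto
    finally show ?thesis by simp
  qed
  then show thesis
    using that c_bounds by blast
qed

lemma cesaro_mean_compose_id_diff_tendsto_0:
  assumes "-1 < a" "a < b" "0 \<le> b" "cesaro_bounded a T"
  shows "(\<lambda>n. cesaro_mean b T n o\<^sub>L (id_blinfun - T)) \<longlonglongrightarrow> 0"
proof -
  obtain C c where "c < b"
    and sum_le: "\<And>n. norm (cesaro_sum (b - 1) T n) \<le> C * cesaro_number (c + 1) n"
    using norm_cesaro_sum_pred_le assms by metis
  let ?k = "\<lambda>n. cesaro_number (b + 1) n"
  let ?e = "\<lambda>n. cesaro_number b (Suc n) / ?k n + C * (cesaro_number (c + 1) (Suc n) / ?k n)"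
  have "norm (cesaro_mean b T n o\<^sub>L (id_blinfun - T)) \<le> ?e n" for n
  proof -
    have k_pos: "0 < ?k n"
      using assms by (intro cesaro_number_pos) simp
    have "norm (cesaro_number b (Suc n) *\<^sub>R (id_blinfun :: 'a \<Rightarrow>\<^sub>L 'a)) \<le> cesaro_number b (Suc n)"
      using assms cesaro_number_nonneg [of b "Suc n"]
      by (simp add: mult_left_le norm_blinfun_id_le)
    then have sum_le_e: "norm (cesaro_sum b T n o\<^sub>L (id_blinfun - T)) \<le> ?k n * ?e n"
      unfolding cesaro_sum_compose_id_diff using sum_le [of "Suc n"] k_pos
      by (intro order_trans [OF norm_triangle_ineq4]) (simp add: distrib_left)
    have "cesaro_mean b T n o\<^sub>L (id_blinfun - T)
        = (1 / ?k n) *\<^sub>R (cesaro_sum b T n o\<^sub>L (id_blinfun - T))"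
      unfolding cesaro_mean_def by (rule blinfun_eqI) (simp add: blinfun.scaleR_left)
    then show ?thesis
      using sum_le_e k_pos by (simp add: pos_divide_le_eq mult.commute)
  qed
  moreover have "?e \<longlonglongrightarrow> 0"
  proof -
    have "?e \<longlonglongrightarrow> 0 + C * 0"
      using assms \<open>c < b\<close> by (intro tendsto_intros cesaro_number_Suc_ratio_tendsto_0) auto
    then show ?thesis by simp
  qed
  ultimately show ?thesis
    by (rule Lim_null_comparison [OF always_eventually, OF allI])
qed

lemma ergodic_net_cesaro_mean:
  assumes "-1 < a" "a < b" "0 \<le> b" "cesaro_bounded a T"
  shows "ergodic_net (id_blinfun - T) (cesaro_mean b T) sequentially"
proof
  have "cesaro_bounded b T"
    using cesaro_bounded_mono [of a b T] assms by simp
  then show "bounded (range (cesaro_mean b T))"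
    by (simp add: cesaro_bounded_def image_image flip: bdd_above_norm)
  show "cesaro_mean b T n x = x" if "(id_blinfun - T) x = 0" for n x
    using that assms by (intro cesaro_mean_fixed) (simp_all add: blinfun.diff_left)
  show "x - cesaro_mean b T n x \<in> closure (range (id_blinfun - T))" for n x
    using assms by (intro subsetD [OF closure_subset] diff_cesaro_mean_in_range) simp
  have "(\<lambda>n. (cesaro_mean b T n o\<^sub>L (id_blinfun - T)) x) \<longlonglongrightarrow> blinfun_apply 0 x" for x
    by (intro tendsto_intros cesaro_mean_compose_id_diff_tendsto_0 [OF assms])
  then show mean_range: "(\<lambda>n. cesaro_mean b T n ((id_blinfun - T) x)) \<longlonglongrightarrow> 0" for x
    by simp
  have "(id_blinfun - T) (cesaro_mean b T n x) = cesaro_mean b T n ((id_blinfun - T) x)" for n x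
    by (simp add: blinfun.diff_left blinfun.diff_right cesaro_mean_commute)
  then show "(\<lambda>n. (id_blinfun - T) (cesaro_mean b T n x)) \<longlonglongrightarrow> 0" for x
    using mean_range by simp
qed simp

theorem theorem3:
  fixes T :: "'a::complex_banach \<Rightarrow>\<^sub>L 'a" and \<alpha> \<beta> :: real
  assumes "0 \<le> \<alpha>"
    and "complex_homogeneous T"
    and "cesaro_bounded \<alpha> T"
    and "\<alpha> < \<beta>"
  shows "cesaro_ergodic \<beta> T \<longleftrightarrow>
    topological_direct_sum {x. blinfun_apply (id_blinfun - T) x = 0}
      (closure (range (blinfun_apply (id_blinfun - T))))"
    (is "_ \<longleftrightarrow> topological_direct_sum ?K (closure ?R)")
proof -
  interpret ergodic_net "id_blinfun - T" "cesaro_mean \<beta> T" sequentially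
    using assms by (intro ergodic_net_cesaro_mean [of \<alpha>]) simp_all
  have "complex_homogeneous (id_blinfun - T)"
    using assms(2) by (rule complex_homogeneous_id_diff)
  then have "csubspace ?K" "csubspace (closure ?R)"
    by (simp_all add: csubspace_kernel csubspace_closure csubspace_range)
  then show ?thesis
    unfolding cesaro_ergodic_def convergent_def topological_direct_sum_def
    using all_convergent_iff_direct_sum by simp
qed

end
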